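(* Let $N$ be a composite positive integer. For each pair of positive integers $d,d'$ with $N=d\cdot d'$ and $1<d\le d'$, the number $N$ is expressible as an arithmetic series of $d$ positive integers with common difference $2$, namely $$N=(d'-d+1)+(d'-d+3)+\cdots+(d'+d-1).$$ *)

theory Defs
  imports "HOL-Computational_Algebra.Primes"
begin

definition composite :: "nat \<Rightarrow> bool" where
  "composite n \<longleftrightarrow> n > 1 \<and> \<not> prime n"

definition arithmetic_progression :: "int \<Rightarrow> int list \<Rightarrow> bool" where
  "arithmetic_progression c ts \<longleftrightarrow> successively (\<lambda>s t. t - s = c) ts"

end

theory Submission
  imports Defs
begin

text \<open>
  The \<^term>\<open>d\<close> terms \<open>d' - d + 1, d' - d + 3, ..., d' + d - 1\<close> are placed symmetrically about
  \<^term>\<open>d'\<close>, so their mean is \<^term>\<open>d'\<close> and their sum is \<open>d * d'\<close>. The smallest of them is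
  positive because \<open>d \<le> d'\<close>. In \<open>sum_list_odd_offsets\<close> the offsets are the first \<open>n\<close> odd
  numbers, which contribute \<open>n\<^sup>2\<close>; for the starting point \<open>a = d' - d\<close> and \<open>n = d\<close> this
  cancels against the \<open>- d\<^sup>2\<close> in \<open>d * a\<close>.
\<close>

lemma sum_list_odd_offsets:
  fixes a :: int
  shows "(\<Sum>i\<leftarrow>[0..<n]. a + 2 * int i + 1) = int n * (a + int n)"
  by (induction n) (simp_all add: algebra_simps)

lemma arithmetic_progression_map_upt:
  assumes "\<And>i. f (Suc i) - f i = c"
  shows "arithmetic_progression c (map f [0..<n])"
  unfolding arithmetic_progression_def successively_conv_nth
  using assms by simp

theorem theorem1:
  fixes N d d' :: nat
  assumes "composite N"
    and "d > 0" and "d' > 0"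
    and "N = d * d'"
    and "1 < d" and "d \<le> d'"
  shows "\<exists>ts :: int list.
      length ts = d \<and> (\<forall>t\<in>set ts. t > 0) \<and> arithmetic_progression 2 ts \<and>
      hd ts = int d' - int d + 1 \<and> ts ! 1 = int d' - int d + 3 \<and>
      last ts = int d' + int d - 1 \<and>
      int N = sum_list ts"
proof -
  define f where "f i = (int d' - int d) + 2 * int i + 1" for i
  let ?ts = "map f [0..<d]"
  have "\<forall>t\<in>set ?ts. t > 0"
    using \<open>d \<le> d'\<close> by (auto simp: f_def)
  moreover have "arithmetic_progression 2 ?ts"
    by (rule arithmetic_progression_map_upt) (simp add: f_def)
  moreover have "hd ?ts = int d' - int d + 1"
    using \<open>1 < d\<close> by (simp add: hd_map f_def)
  moreover have "?ts ! 1 = int d' - int d + 3"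
    using \<open>1 < d\<close> by (simp add: f_def)
  moreover have "last ?ts = int d' + int d - 1"
    using \<open>1 < d\<close> by (simp add: last_map f_def of_nat_diff)
  moreover have "int N = sum_list ?ts"
    unfolding f_def sum_list_odd_offsets using \<open>N = d * d'\<close> by simp
  ultimately show ?thesis
    by (intro exI[of _ ?ts]) simp
qed

end
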